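(* Let $S$ be a disjunctive sum of Shrubs. Let $S^*=S+*$ if every Shrub in the sum has normal-play nim-value $1$, and $S^*=S$ otherwise. Then $o^+(S)=o^-(S^* )$ and $o^+(S^* )=o^-(S)$.
   Context: Green Hackenbush: a position is a finite graph with green edges and designated ground vertices; either player may cut any edge, after which components disconnected from the ground are discarded. Under normal play the last player to move wins; under misère play the last player to move loses. $o^+$ and $o^-$ denote normal and misère outcome classes ($\mathcal N$: next player wins; $\mathcal P$: previous player wins). A Shrub is a rooted graph with all edges green whose root has degree one and is the only ground vertex. $*$ is a single green edge on the ground. The normal-play nim-value $g^+(G)$ is defined recursively as the least non-negative integer not equal to the nim-value of an option of $G$. *)

theory Defs
  imports Main "HOL-Library.FSet"
begin

section \<open>Impartial games\<close>

text \<open>Positions of finite impartial games, given by their finite sets of options.\<close>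

datatype game = Game (options: "game fset")

datatype outcome = Next_Wins | Previous_Wins

primrec outcome_normal :: "game \<Rightarrow> outcome" where
  "outcome_normal (Game Xs) =
     (if Previous_Wins |\<in>| outcome_normal |`| Xs then Next_Wins else Previous_Wins)"

text \<open>A player who cannot move wins under misere play: the opponent made the last move.\<close>

primrec outcome_misere :: "game \<Rightarrow> outcome" where
  "outcome_misere (Game Xs) =
     (if Xs = {||} \<or> Previous_Wins |\<in>| outcome_misere |`| Xs
      then Next_Wins else Previous_Wins)"

primrec nim_value :: "game \<Rightarrow> nat" where
  "nim_value (Game Xs) = (LEAST n. n |\<notin>| nim_value |`| Xs)"

lemma size_option_less: "X |\<in>| options G \<Longrightarrow> size X < size G"
proof (cases G)
  case (Game Xs)
  assume "X |\<in>| options G"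
  then have "X \<in> fset Xs"
    by (simp add: Game)
  then have "Suc (size X) \<le> (\<Sum>Y\<in>fset Xs. Suc (size Y))"
    by (intro member_le_sum) auto
  then show ?thesis
    by (simp add: Game size_fset_overloaded_simps)
qed

function game_plus :: "game \<Rightarrow> game \<Rightarrow> game" (infixl "\<oplus>" 65) where
  "G \<oplus> H = Game ((\<lambda>G'. G' \<oplus> H) |`| options G |\<union>| (\<lambda>H'. G \<oplus> H') |`| options H)"
  by pat_completeness auto
termination
  by (relation "measure (\<lambda>(G, H). size G + size H)") (auto simp: size_option_less)

declare game_plus.simps [simp del]

definition game_sum :: "game list \<Rightarrow> game" where
  "game_sum Gs = foldr (\<oplus>) Gs (Game {||})"


section \<open>Green Hackenbush\<close>

text \<open>Graphs are finite undirected multigraphs: parallel edges are allowed, and an edge with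
  a single end is a loop.\<close>

record ('v, 'e) ground_graph =
  verts :: "'v fset"
  edges :: "'e fset"
  ends :: "'e \<Rightarrow> 'v set"
  ground :: "'v fset"

inductive grounded :: "('v, 'e) ground_graph \<Rightarrow> 'v \<Rightarrow> bool" for G where
  base: "v |\<in>| ground G \<Longrightarrow> grounded G v"
| step: "grounded G v \<Longrightarrow> e |\<in>| edges G \<Longrightarrow> v \<in> ends G e \<Longrightarrow> w \<in> ends G e \<Longrightarrow> grounded G w"

text \<open>Since components not connected to the ground are discarded, a position has none.\<close>

definition hackenbush_position :: "('v, 'e) ground_graph \<Rightarrow> bool" where
  "hackenbush_position G \<longleftrightarrow>
     ground G |\<subseteq>| verts G \<and>
     (\<forall>e. e |\<in>| edges G \<longrightarrow> ends G e \<subseteq> fset (verts G) \<and> card (ends G e) \<in> {1, 2}) \<and>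
     (\<forall>v. v |\<in>| verts G \<longrightarrow> grounded G v)"

definition delete_edge :: "'e \<Rightarrow> ('v, 'e) ground_graph \<Rightarrow> ('v, 'e) ground_graph" where
  "delete_edge e G = G\<lparr>edges := edges G |-| {|e|}\<rparr>"

definition discard_ungrounded :: "('v, 'e) ground_graph \<Rightarrow> ('v, 'e) ground_graph" where
  "discard_ungrounded G =
     G\<lparr>verts := ffilter (grounded G) (verts G),
       edges := ffilter (\<lambda>e. \<forall>v \<in> ends G e. grounded G v) (edges G)\<rparr>"

definition cut :: "'e \<Rightarrow> ('v, 'e) ground_graph \<Rightarrow> ('v, 'e) ground_graph" where
  "cut e G = discard_ungrounded (delete_edge e G)"

lemma fcard_edges_cut_less: "e |\<in>| edges G \<Longrightarrow> fcard (edges (cut e G)) < fcard (edges G)"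
  by (rule pfsubset_fcard_mono) (auto simp: cut_def delete_edge_def discard_ungrounded_def)

function hackenbush_game :: "('v, 'e) ground_graph \<Rightarrow> game" where
  "hackenbush_game G = Game ((\<lambda>e. hackenbush_game (cut e G)) |`| edges G)"
  by pat_completeness auto
termination
  by (relation "measure (\<lambda>G. fcard (edges G))") (auto simp: fcard_edges_cut_less)

declare hackenbush_game.simps [simp del]

text \<open>A loop contributes two to the degree.\<close>

definition degree :: "('v, 'e) ground_graph \<Rightarrow> 'v \<Rightarrow> nat" where
  "degree G v =
     fcard (ffilter (\<lambda>e. v \<in> ends G e) (edges G)) +
     fcard (ffilter (\<lambda>e. ends G e = {v}) (edges G))"

definition shrub :: "('v, 'e) ground_graph \<Rightarrow> bool" where
  "shrub G \<longleftrightarrow> hackenbush_position G \<and> (\<exists>r. ground G = {|r|} \<and> degree G r = 1)"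

definition single_edge :: "(nat, nat) ground_graph" where
  "single_edge = \<lparr>verts = {|0, 1|}, edges = {|0|}, ends = (\<lambda>_. {0, 1}), ground = {|0|}\<rparr>"

definition star :: game where
  "star = hackenbush_game single_edge"

lemma star_eq: "star = Game {|Game {||}|}"
proof -
  have "edges (cut 0 single_edge) = {||}"
    by (auto simp: cut_def delete_edge_def discard_ungrounded_def single_edge_def)
  then have "hackenbush_game (cut 0 single_edge) = Game {||}"
    by (subst hackenbush_game.simps) simp
  then show ?thesis
    unfolding star_def by (subst hackenbush_game.simps) (simp add: single_edge_def)
qed

lemma shrub_single_edge: "shrub single_edge"
proof -
  have 0: "grounded single_edge 0"
    by (rule grounded.base) (simp add: single_edge_def)
  have "grounded single_edge 1"
    by (rule grounded.step[OF 0, of 0]) (simp_all add: single_edge_def)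
  moreover have "degree single_edge 0 = 1"
  proof -
    have "ffilter (\<lambda>e. 0 \<in> ends single_edge e) (edges single_edge) = {|0|}"
      "ffilter (\<lambda>e. ends single_edge e = {0}) (edges single_edge) = {||}"
      by (auto simp: single_edge_def)
    then show ?thesis
      by (simp add: degree_def fcard_finsert_disjoint)
  qed
  ultimately show ?thesis
    using 0 by (auto simp: shrub_def hackenbush_position_def single_edge_def)
qed

end

theory Submission
  imports Defs
begin

text \<open>Cutting the trunk of a Shrub leaves nothing, and cutting any other edge leaves a Shrub, so
  all options of a Shrub are \<open>0\<close> or Shrubs, and \<open>0\<close> is one of them. Call a Shrub big if its
  nim-value is not \<open>1\<close>; a big Shrub has both \<open>0\<close> and a Shrub of value \<open>1\<close> as options, whereas no
  option of a Shrub of value \<open>1\<close> is a Shrub of value \<open>1\<close>.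
  By simultaneous induction on the sum, a sum of \<open>n\<close> Shrubs of value \<open>1\<close> is a \<open>\<P>\<close>-position of
  normal play iff \<open>n\<close> is even, and of misere play iff \<open>n\<close> is odd. If there is exactly one big Shrub,
  moving it to \<open>0\<close> or to a Shrub of value \<open>1\<close> selects the parity of \<open>n\<close>, so the next player wins
  under either convention; if there are at least two, every option still has a big Shrub, and the
  two outcomes agree by induction.\<close>

section \<open>Outcomes, nim-values and moves in sums of impartial games\<close>

lemma next_wins_iff: "x = Next_Wins \<longleftrightarrow> Previous_Wins \<noteq> x"
  by (cases x) auto

lemma outcome_normal_previous_iff:
  "outcome_normal G = Previous_Wins \<longleftrightarrow>
     (\<forall>X. X |\<in>| options G \<longrightarrow> outcome_normal X = Next_Wins)"
  by (cases G) (auto simp: next_wins_iff)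

lemma outcome_misere_previous_iff:
  "outcome_misere G = Previous_Wins \<longleftrightarrow>
     options G \<noteq> {||} \<and> (\<forall>X. X |\<in>| options G \<longrightarrow> outcome_misere X = Next_Wins)"
  by (cases G) (auto simp: next_wins_iff)

text \<open>The options have finitely many nim-values, so some number is missing among them and the
  \<open>LEAST\<close> is itself a missing number.\<close>

lemma nim_value_option_neq:
  assumes "X |\<in>| options G"
  shows "nim_value X \<noteq> nim_value G"
proof (cases G)
  case (Game Xs)
  have "finite (fset (nim_value |`| Xs))"
    by simp
  then have "\<exists>n. n |\<notin>| nim_value |`| Xs"
    by (meson ex_new_if_finite infinite_UNIV_nat)
  then have "(LEAST n. n |\<notin>| nim_value |`| Xs) |\<notin>| nim_value |`| Xs"
    by (rule LeastI_ex)
  moreover have "nim_value X |\<in>| nim_value |`| Xs"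
    using assms by (simp add: Game)
  ultimately show ?thesis
    unfolding Game nim_value.simps by metis
qed

lemma nim_value_less_option:
  assumes "n < nim_value G"
  obtains X where "X |\<in>| options G" "nim_value X = n"
  using assms by (cases G) (auto dest: not_less_Least)

lemma nim_value_zero_game: "nim_value (Game {||}) = 0"
  by simp

lemma options_game_plus:
  "options (G \<oplus> H) = (\<lambda>G'. G' \<oplus> H) |`| options G |\<union>| (\<lambda>H'. G \<oplus> H') |`| options H"
  by (subst game_plus.simps) simp

lemma game_plus_commute: "G \<oplus> H = H \<oplus> G"
proof (induction G H rule: game_plus.induct)
  case (1 G H)
  have "(\<lambda>G'. G' \<oplus> H) |`| options G = (\<lambda>G'. H \<oplus> G') |`| options G"
    "(\<lambda>H'. G \<oplus> H') |`| options H = (\<lambda>H'. H' \<oplus> G) |`| options H"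
    by (auto intro!: fset.map_cong0 simp: 1)
  then show ?case
    by (intro game.expand) (simp add: options_game_plus sup_commute)
qed

lemma game_sum_Cons [simp]: "game_sum (G # Gs) = G \<oplus> game_sum Gs"
  by (simp add: game_sum_def)

text \<open>Marking the moved component by its position in the list leaves the other components
  untouched, so the effect of a move on additive counts over the list can be read off
  directly.\<close>

lemma options_game_sum_iff:
  "X |\<in>| options (game_sum Gs) \<longleftrightarrow>
     (\<exists>As G Bs G'. Gs = As @ G # Bs \<and> G' |\<in>| options G \<and> X = game_sum (As @ G' # Bs))"
proof (induction Gs arbitrary: X)
  case Nil
  then show ?case
    by (simp add: game_sum_def)
next
  case (Cons H Gs)
  show ?case (is "_ \<longleftrightarrow> ?R")
  proof
    assume "X |\<in>| options (game_sum (H # Gs))"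
    then consider H' where "H' |\<in>| options H" "X = H' \<oplus> game_sum Gs"
      | Y where "Y |\<in>| options (game_sum Gs)" "X = H \<oplus> Y"
      by (auto simp: options_game_plus)
    then show ?R
    proof cases
      case 1
      then show ?thesis
        by (intro exI[of _ "[]"] exI[of _ H] exI[of _ Gs] exI[of _ H']) simp
    next
      case 2
      then obtain As G Bs G' where "Gs = As @ G # Bs" "G' |\<in>| options G"
        "Y = game_sum (As @ G' # Bs)"
        using Cons.IH by blast
      with 2 show ?thesis
        by (intro exI[of _ "H # As"] exI[of _ G] exI[of _ Bs] exI[of _ G']) simp
    qed
  next
    assume ?R
    then obtain As G Bs G' where eq: "H # Gs = As @ G # Bs" "G' |\<in>| options G"
        "X = game_sum (As @ G' # Bs)"
      by blast
    show "X |\<in>| options (game_sum (H # Gs))"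
    proof (cases As)
      case Nil
      with eq show ?thesis
        by (simp add: options_game_plus)
    next
      case (Cons A As')
      with eq have "game_sum (As' @ G' # Bs) |\<in>| options (game_sum Gs)"
        using Cons.IH by auto
      with Cons eq show ?thesis
        by (simp add: options_game_plus)
    qed
  qed
qed

section \<open>Abstract Shrubs and the outcomes of their sums\<close>

text \<open>This hereditary property keeps what the outcome analysis needs from Shrubs and forgets
  the graphs.\<close>

inductive shrub_game :: "game \<Rightarrow> bool" where
  "Game {||} |\<in>| options G \<Longrightarrow>
   (\<And>X. X |\<in>| options G \<Longrightarrow> X = Game {||} \<or> shrub_game X) \<Longrightarrow> shrub_game G"

lemma shrub_game_zero_option: "shrub_game G \<Longrightarrow> Game {||} |\<in>| options G"
  by (auto elim: shrub_game.cases)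

lemma shrub_game_option:
  "shrub_game G \<Longrightarrow> X |\<in>| options G \<Longrightarrow> X = Game {||} \<or> shrub_game X"
  by (auto elim: shrub_game.cases)

lemma shrub_game_nim_value_pos: "shrub_game G \<Longrightarrow> nim_value G > 0"
  using nim_value_option_neq[OF shrub_game_zero_option] by force

text \<open>Zero components enter neither \<open>ones\<close> nor \<open>bigs\<close>, so replacing
  a component by \<open>Game {||}\<close> merely removes it from the counts.\<close>

definition ones :: "game list \<Rightarrow> nat" where
  "ones Gs = length (filter (\<lambda>G. nim_value G = 1) Gs)"

definition bigs :: "game list \<Rightarrow> nat" where
  "bigs Gs = length (filter (\<lambda>G. nim_value G > 1) Gs)"

lemma ones_append [simp]: "ones (As @ Bs) = ones As + ones Bs"
  and bigs_append [simp]: "bigs (As @ Bs) = bigs As + bigs Bs"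
  and ones_Cons [simp]: "ones (G # Gs) = (if nim_value G = 1 then 1 else 0) + ones Gs"
  and bigs_Cons [simp]: "bigs (G # Gs) = (if nim_value G > 1 then 1 else 0) + bigs Gs"
  by (simp_all add: ones_def bigs_def)

text \<open>Components \<open>0\<close> are admitted, so that the class of lists is closed under moves.\<close>

lemma outcomes_shrub_game_sum:
  assumes "\<forall>G \<in> set Gs. G = Game {||} \<or> shrub_game G"
  shows "(bigs Gs = 0 \<longrightarrow>
           (outcome_normal (game_sum Gs) = Previous_Wins \<longleftrightarrow> even (ones Gs)) \<and>
           (outcome_misere (game_sum Gs) = Previous_Wins \<longleftrightarrow> odd (ones Gs))) \<and>
         (bigs Gs = 1 \<longrightarrow>
           outcome_normal (game_sum Gs) = Next_Wins \<and>
           outcome_misere (game_sum Gs) = Next_Wins) \<and>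
         (bigs Gs \<ge> 1 \<longrightarrow> outcome_normal (game_sum Gs) = outcome_misere (game_sum Gs))"
    (is "?P Gs")
  using assms
\<comment> \<open>A move keeps the length of the list but makes the sum, as a game, smaller.\<close>
proof (induction "size (game_sum Gs)" arbitrary: Gs rule: less_induct)
  case less
  let ?S = "game_sum Gs"
  have option: "game_sum (As @ G' # Bs) |\<in>| options ?S \<and> ?P (As @ G' # Bs)"
    if "Gs = As @ G # Bs" "G' |\<in>| options G" for As G Bs G'
  proof -
    have mem: "game_sum (As @ G' # Bs) |\<in>| options ?S"
      using that options_game_sum_iff by blast
    \<comment> \<open>\<open>G\<close> has an option, so it is not the zero game.\<close>
    have "shrub_game G"
      using that less.prems by auto
    then have "\<forall>H \<in> set (As @ G' # Bs). H = Game {||} \<or> shrub_game H"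
      using that less.prems shrub_game_option by auto
    with mem show ?thesis
      using less.hyps size_option_less by blast
  qed
  have move_one: "\<exists>As G Bs. Gs = As @ G # Bs \<and> shrub_game G \<and> nim_value G = 1"
    if pos: "ones Gs > 0"
  proof -
    obtain G where G: "G \<in> set Gs" "nim_value G = 1"
      using pos by (auto simp: ones_def filter_empty_conv)
    then show ?thesis
      using less.prems by (metis nim_value_zero_game split_list zero_neq_one)
  qed
  \<comment> \<open>Since the nim-value is a minimal excluded number, a value above 1 forces an
    option of value 1.\<close>
  have move_big: "\<exists>As G Bs H. Gs = As @ G # Bs \<and> nim_value G > 1 \<and> Game {||} |\<in>| options G \<and>
      H |\<in>| options G \<and> nim_value H = 1" if pos: "bigs Gs > 0"
  proof -
    obtain G where G: "G \<in> set Gs" "nim_value G > 1"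
      using pos by (auto simp: bigs_def filter_empty_conv)
    then have "shrub_game G"
      using less.prems by force
    moreover obtain H where "H |\<in>| options G" "nim_value H = 1"
      using G(2) by (rule nim_value_less_option)
    ultimately show ?thesis
      using G split_list shrub_game_zero_option by metis
  qed
  consider "bigs Gs = 0" | "bigs Gs = 1" | "bigs Gs \<ge> 2"
    by linarith
  then show ?case
  proof cases
    case 1
    \<comment> \<open>Every move is in a component of value 1 and changes that value. A new value
      above 1 creates the only big component, so the next player wins under both conventions; the
      new value 0 lowers \<open>ones\<close> by one and flips the parity.\<close>
    have opts: "outcome_normal X = Next_Wins \<and> outcome_misere X = Next_Wins \<or>
        ones Gs > 0 \<and> (outcome_normal X = Previous_Wins \<longleftrightarrow> odd (ones Gs)) \<and>
        (outcome_misere X = Previous_Wins \<longleftrightarrow> even (ones Gs))"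
      if X: "X |\<in>| options ?S" for X
    proof -
      obtain As G Bs G' where eq: "Gs = As @ G # Bs" and G': "G' |\<in>| options G"
        and X_eq: "X = game_sum (As @ G' # Bs)"
        using X options_game_sum_iff by blast
      have "shrub_game G"
        using eq G' less.prems by auto
      then have G: "nim_value G = 1"
        using 1 shrub_game_nim_value_pos[of G] by (simp add: eq split: if_splits)
      moreover have "nim_value G' \<noteq> nim_value G"
        using G' by (rule nim_value_option_neq)
      ultimately consider "bigs (As @ G' # Bs) = 1"
        | "bigs (As @ G' # Bs) = 0" "Suc (ones (As @ G' # Bs)) = ones Gs"
        using 1 by (cases "nim_value G' > 1") (simp_all add: eq)
      then show ?thesis
      proof cases
        case 1
        with option[OF eq G'] show ?thesis
          unfolding X_eq by blast
      next
        case 2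
        then have "ones Gs > 0" "odd (ones Gs) \<longleftrightarrow> even (ones (As @ G' # Bs))"
          by (auto simp flip: 2(2))
        with option[OF eq G'] 2(1) show ?thesis
          unfolding X_eq by blast
      qed
    qed
    \<comment> \<open>The parity flip is always available: a component of value 1 can be moved to
      0.\<close>
    have option_ex: "\<exists>X. X |\<in>| options ?S \<and>
        (outcome_normal X = Previous_Wins \<longleftrightarrow> odd (ones Gs)) \<and>
        (outcome_misere X = Previous_Wins \<longleftrightarrow> even (ones Gs))" if pos: "ones Gs > 0"
    proof -
      obtain As G Bs where eq: "Gs = As @ G # Bs" and G: "shrub_game G" "nim_value G = 1"
        using move_one[OF pos] by blast
      let ?Z = "As @ Game {||} # Bs"
      have "bigs ?Z = 0" "odd (ones Gs) \<longleftrightarrow> even (ones ?Z)"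
        using 1 G by (auto simp: eq)
      with option[OF eq shrub_game_zero_option[OF G(1)]] show ?thesis
        by blast
    qed
    have normal: "outcome_normal ?S = Previous_Wins \<longleftrightarrow> even (ones Gs)"
    proof (cases "even (ones Gs)")
      case True
      then have "outcome_normal X \<noteq> Previous_Wins" if "X |\<in>| options ?S" for X
        using opts[OF that] by auto
      then have "outcome_normal X = Next_Wins" if "X |\<in>| options ?S" for X
        using that outcome.exhaust by metis
      with True show ?thesis
        using outcome_normal_previous_iff[of ?S] by blast
    next
      case False
      with option_ex[OF odd_pos] show ?thesis
        unfolding outcome_normal_previous_iff[of ?S] by force
    qed
    have misere: "outcome_misere ?S = Previous_Wins \<longleftrightarrow> odd (ones Gs)"
    proof (cases "odd (ones Gs)")
      case True
      then have "outcome_misere X \<noteq> Previous_Wins" if "X |\<in>| options ?S" for X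
        using opts[OF that] by auto
      then have "outcome_misere X = Next_Wins" if "X |\<in>| options ?S" for X
        using that outcome.exhaust by metis
      moreover have "options ?S \<noteq> {||}"
        using option_ex[OF odd_pos[OF True]] by auto
      ultimately show ?thesis
        using True outcome_misere_previous_iff[of ?S] by blast
    next
      case even: False
      show ?thesis
      \<comment> \<open>With \<open>ones\<close> equal to 0 every component is zero, so no move
        exists and the misere convention itself makes the next player win; a positive even count
        needs an actual winning move.\<close>
      proof (cases "ones Gs = 0")
        case True
        then have "nim_value G \<noteq> 1" "\<not> nim_value G > 1" if "G \<in> set Gs" for G
          using that 1 by (auto simp: ones_def bigs_def filter_empty_conv)
        then have "nim_value G = 0" if "G \<in> set Gs" for G
          using that by (metis less_one linorder_neqE_nat)
        then have "G = Game {||}" if "G \<in> set Gs" for G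
          using that less.prems shrub_game_nim_value_pos by fastforce
        then have "options G = {||}" if "G \<in> set Gs" for G
          using that by fastforce
        then have "X |\<notin>| options ?S" for X
          unfolding options_game_sum_iff by auto
        then have "options ?S = {||}"
          by blast
        with even show ?thesis
          by (simp add: outcome_misere_previous_iff[of ?S])
      next
        case False
        with even option_ex show ?thesis
          unfolding outcome_misere_previous_iff[of ?S] by force
      qed
    qed
    show ?thesis
      using 1 normal misere by simp
  next
    case 2
    then obtain As G Bs H where eq: "Gs = As @ G # Bs" and G: "nim_value G > 1"
      and zero: "Game {||} |\<in>| options G" and H: "H |\<in>| options G" "nim_value H = 1"
      using move_big by force
    \<comment> \<open>Both moves remove the only big component, and the resulting counts of value 1
      differ by one. Hence under each convention exactly one of the two positions is lost for the
      player to move.\<close>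
    let ?Z = "As @ Game {||} # Bs" and ?H = "As @ H # Bs"
    have "bigs ?Z = 0" "bigs ?H = 0" and ones: "ones ?H = Suc (ones ?Z)"
      using 2 G H(2) by (auto simp: eq)
    with option[OF eq zero] option[OF eq H(1)]
    have Z: "game_sum ?Z |\<in>| options ?S"
      "outcome_normal (game_sum ?Z) = Previous_Wins \<longleftrightarrow> even (ones ?Z)"
      "outcome_misere (game_sum ?Z) = Previous_Wins \<longleftrightarrow> odd (ones ?Z)"
      and H': "game_sum ?H |\<in>| options ?S"
      "outcome_normal (game_sum ?H) = Previous_Wins \<longleftrightarrow> odd (ones ?Z)"
      "outcome_misere (game_sum ?H) = Previous_Wins \<longleftrightarrow> even (ones ?Z)"
      by (simp_all only: even_Suc simp_thms)
    have "outcome_normal ?S \<noteq> Previous_Wins"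
      using Z(1,2) H'(1,2) unfolding outcome_normal_previous_iff[of ?S]
      by (metis outcome.distinct(1))
    moreover have "outcome_misere ?S \<noteq> Previous_Wins"
      using Z(1,3) H'(1,3) unfolding outcome_misere_previous_iff[of ?S]
      by (metis outcome.distinct(1))
    ultimately have "outcome_normal ?S = Next_Wins" "outcome_misere ?S = Next_Wins"
      using outcome.exhaust by auto
    with 2 show ?thesis
      by simp
  next
    case 3
    have "outcome_normal X = outcome_misere X" if X: "X |\<in>| options ?S" for X
    proof -
      obtain As G Bs G' where eq: "Gs = As @ G # Bs" and G': "G' |\<in>| options G"
        and X_eq: "X = game_sum (As @ G' # Bs)"
        using X options_game_sum_iff by blast
      \<comment> \<open>A move changes a single component, so at most one big component
        disappears.\<close>
      have "bigs (As @ G' # Bs) \<ge> 1"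
        using 3 by (simp add: eq split: if_splits)
      with option[OF eq G'] X_eq show ?thesis
        by simp
    qed
    \<comment> \<open>At a terminal position the two conventions would disagree even though all
      options agree vacuously.\<close>
    moreover have "options ?S \<noteq> {||}"
    proof -
      obtain As G Bs where "Gs = As @ G # Bs" "Game {||} |\<in>| options G"
        using 3 move_big by force
      with option show ?thesis
        by blast
    qed
    ultimately have "outcome_normal ?S = Previous_Wins \<longleftrightarrow> outcome_misere ?S = Previous_Wins"
      by (auto simp: outcome_normal_previous_iff[of ?S] outcome_misere_previous_iff[of ?S])
    then have "outcome_normal ?S = outcome_misere ?S"
      using outcome.exhaust by metis
    with 3 show ?thesis
      by simp
  qed
qed

section \<open>Cutting edges of Shrub graphs\<close>

lemma options_hackenbush_game:
  "options (hackenbush_game G) = (\<lambda>e. hackenbush_game (cut e G)) |`| edges G"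
  by (subst hackenbush_game.simps) simp

lemma ends_cut [simp]: "ends (cut e G) = ends G"
  and ground_cut [simp]: "ground (cut e G) = ground G"
  and edges_cut: "edges (cut e G) =
    ffilter (\<lambda>d. \<forall>v \<in> ends G d. grounded (delete_edge e G) v) (edges G |-| {|e|})"
  and verts_cut: "verts (cut e G) = ffilter (grounded (delete_edge e G)) (verts G)"
  by (simp_all add: cut_def discard_ungrounded_def delete_edge_def)

text \<open>Discarding removes only edges with an ungrounded end, whereas all ends of the edges on a
  path from the ground are grounded. Such a path therefore survives.\<close>

lemma grounded_cut:
  assumes "grounded (delete_edge e G) v"
  shows "grounded (cut e G) v"
  using assms
proof induction
  case (base v)
  then show ?case
    by (auto simp: delete_edge_def intro: grounded.base)
next
  case (step v d w)
  have "d |\<in>| edges (cut e G)"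
    using step.hyps by (auto simp: edges_cut delete_edge_def intro: grounded.step)
  with step show ?case
    by (auto simp: delete_edge_def intro: grounded.step)
qed

text \<open>A loop at the root would count in both summands of the degree, giving at least 2. So
  degree one means a single edge at the root, the trunk \<open>t\<close>, which is not a
  loop.\<close>

lemma shrub_trunk:
  assumes "shrub G"
  obtains r t where "ground G = {|r|}" "r |\<in>| verts G" "t |\<in>| edges G"
    "\<And>e. e |\<in>| edges G \<Longrightarrow> r \<in> ends G e \<longleftrightarrow> e = t" "ends G t \<noteq> {r}"
proof -
  obtain r where r: "ground G = {|r|}" and deg: "degree G r = 1" and pos: "hackenbush_position G"
    using assms by (auto simp: shrub_def)
  let ?A = "ffilter (\<lambda>e. r \<in> ends G e) (edges G)"
  let ?L = "ffilter (\<lambda>e. ends G e = {r}) (edges G)"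
  have sub: "?L |\<subseteq>| ?A"
    by auto
  have sum: "fcard ?A + fcard ?L = 1"
    using deg by (simp add: degree_def)
  with fcard_mono[OF sub] have L: "fcard ?L = 0" and A: "fcard ?A = 1"
    by linarith+
  from A obtain t where t: "?A = {|t|}"
    using card_1_singletonE[of "fset ?A"] by (metis fcard.rep_eq fset_inject finsert.rep_eq bot_fset.rep_eq)
  have "r |\<in>| verts G"
    using r pos by (simp add: hackenbush_position_def)
  moreover have "t |\<in>| edges G" "\<And>e. e |\<in>| edges G \<Longrightarrow> r \<in> ends G e \<longleftrightarrow> e = t"
    using t by (auto simp: fset_eq_iff)
  moreover have "ends G t \<noteq> {r}"
    using L \<open>t |\<in>| edges G\<close> by (auto simp: fset_eq_iff)
  ultimately show ?thesis
    using r that by blast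
qed

text \<open>An edge that avoids the root is not the trunk. The trunk thus stays attached to the
  ground, and it remains the only edge at the root.\<close>

lemma shrub_cut:
  assumes shrub: "shrub G" and e: "e |\<in>| edges G" and r: "ground G = {|r|}"
    and r_e: "r \<notin> ends G e"
  shows "shrub (cut e G)"
proof -
  obtain r' t where r': "ground G = {|r'|}" "r' |\<in>| verts G" and t: "t |\<in>| edges G"
    and only: "\<And>d. d |\<in>| edges G \<Longrightarrow> r' \<in> ends G d \<longleftrightarrow> d = t" and loop: "ends G t \<noteq> {r'}"
    using shrub by (rule shrub_trunk) blast
  have [simp]: "r' = r"
    using r r' by simp
  have r_t: "r \<in> ends G t"
    using only[OF t] by simp
  have ground: "grounded (delete_edge e G) r"
    using r by (auto simp: delete_edge_def intro: grounded.base)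
  have "t \<noteq> e"
    using r_e r_t by auto
  then have "grounded (delete_edge e G) v" if "v \<in> ends G t" for v
    using ground that t r_t by (intro grounded.step[OF ground, of t]) (auto simp: delete_edge_def)
  with \<open>t \<noteq> e\<close> t have t_cut: "t |\<in>| edges (cut e G)"
    by (auto simp: edges_cut)
  have sub: "d |\<in>| edges (cut e G) \<Longrightarrow> d |\<in>| edges G" for d
    by (simp add: edges_cut)
  have "ffilter (\<lambda>d. r \<in> ends (cut e G) d) (edges (cut e G)) = {|t|}"
    using only t_cut sub r_t by auto
  moreover have "ffilter (\<lambda>d. ends (cut e G) d = {r}) (edges (cut e G)) = {||}"
  proof -
    have False if "d |\<in>| edges (cut e G)" "ends G d = {r}" for d
      using that only[OF sub[OF that(1)]] loop by simp
    then show ?thesis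
      by auto
  qed
  ultimately have "degree (cut e G) r = 1"
    by (simp add: degree_def fcard_finsert_disjoint)
  moreover have "hackenbush_position (cut e G)"
    using shrub r r' ground
    by (auto simp: shrub_def hackenbush_position_def verts_cut edges_cut intro: grounded_cut)
  ultimately show ?thesis
    using r by (simp add: shrub_def)
qed

text \<open>Without the trunk no edge leaves the root, so the root is the only grounded vertex; an
  edge kept by the cut would have to be a loop there.\<close>

lemma edges_cut_trunk:
  assumes shrub: "shrub G" and t: "t |\<in>| edges G" and r: "ground G = {|r|}" and r_t: "r \<in> ends G t"
  shows "edges (cut t G) = {||}"
proof -
  obtain r' t' where r': "ground G = {|r'|}"
    and only': "\<And>d. d |\<in>| edges G \<Longrightarrow> r' \<in> ends G d \<longleftrightarrow> d = t'"
    using shrub by (rule shrub_trunk) blast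
  have only: "d = t" if "d |\<in>| edges G" "r \<in> ends G d" for d
    using that only' t r_t r r' by auto
  have root: "v = r" if "grounded (delete_edge t G) v" for v
    using that
  proof induction
    case (base v)
    then show ?case
      using r by (simp add: delete_edge_def)
  next
    case (step v d w)
    then show ?case
      using only by (auto simp: delete_edge_def)
  qed
  have False if "d |\<in>| edges (cut t G)" for d
  proof -
    have d: "d |\<in>| edges G" "d \<noteq> t" "\<forall>v \<in> ends G d. v = r"
      using that root by (auto simp: edges_cut)
    \<comment> \<open>An edge without ends would pass the filter in \<open>edges_cut\<close>
      vacuously; positions have no such edge.\<close>
    have "card (ends G d) \<in> {1, 2}"
      using shrub d(1) by (auto simp: shrub_def hackenbush_position_def)
    then have "ends G d \<noteq> {}"
      by auto
    then have "r \<in> ends G d"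
      using d(3) by (metis ex_in_conv)
    with d(1,2) only show False
      by blast
  qed
  then show ?thesis
    by auto
qed

text \<open>This carries the graph facts over to games. The induction is on the number of edges,
  which every cut lowers.\<close>

lemma shrub_game_hackenbush_game:
  assumes "shrub G"
  shows "shrub_game (hackenbush_game G)"
  using assms
proof (induction "fcard (edges G)" arbitrary: G rule: less_induct)
  case less
  obtain r t where r: "ground G = {|r|}" and t: "t |\<in>| edges G"
    and only: "\<And>d. d |\<in>| edges G \<Longrightarrow> r \<in> ends G d \<longleftrightarrow> d = t"
    using less.prems by (rule shrub_trunk) blast
  have trunk: "hackenbush_game (cut t G) = Game {||}"
    using edges_cut_trunk[OF less.prems t r] only[OF t]
    by (subst hackenbush_game.simps) simp
  show ?case
  proof (rule shrub_game.intros)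
    show "Game {||} |\<in>| options (hackenbush_game G)"
      using t trunk by (force simp: options_hackenbush_game)
  next
    fix X assume "X |\<in>| options (hackenbush_game G)"
    then obtain e where e: "e |\<in>| edges G" and X: "X = hackenbush_game (cut e G)"
      by (auto simp: options_hackenbush_game)
    show "X = Game {||} \<or> shrub_game X"
    proof (cases "e = t")
      case True
      then show ?thesis
        using trunk X by simp
    next
      case False
      then have "shrub (cut e G)"
        using only[OF e] shrub_cut[OF less.prems e r] by simp
      with less.hyps[OF fcard_edges_cut_less[OF e]] show ?thesis
        by (simp add: X)
    qed
  qed
qed

section \<open>Comparison of the two conventions after adding a star\<close>

theorem theorem2p4:
  fixes Gs :: "('v, 'e) ground_graph list" and S S_star :: game
  assumes shrubs: "\<forall>G \<in> set Gs. shrub G"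
    and S: "S = game_sum (map hackenbush_game Gs)"
    and S_star: "S_star =
      (if \<forall>G \<in> set Gs. nim_value (hackenbush_game G) = 1 then S \<oplus> star else S)"
  shows "outcome_normal S = outcome_misere S_star \<and> outcome_normal S_star = outcome_misere S"
proof -
  let ?Hs = "map hackenbush_game Gs"
  have Hs: "\<forall>H \<in> set ?Hs. shrub_game H"
    using shrubs shrub_game_hackenbush_game by auto
  have S_out: "outcome_normal S = Previous_Wins \<longleftrightarrow> even (ones ?Hs)"
    "outcome_misere S = Previous_Wins \<longleftrightarrow> odd (ones ?Hs)" if "bigs ?Hs = 0"
    using outcomes_shrub_game_sum[of ?Hs] Hs that by (auto simp: S)
  show ?thesis
  proof (cases "\<forall>G \<in> set Gs. nim_value (hackenbush_game G) = 1")
    case True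
    then have bigs: "bigs ?Hs = 0"
      by (auto simp: bigs_def filter_empty_conv)
    have star: "shrub_game star"
      unfolding star_def by (intro shrub_game_hackenbush_game shrub_single_edge)
    \<comment> \<open>A value above 1 would need an option of value 1, but the only option of
      \<open>star\<close> is the zero game.\<close>
    have nim: "nim_value star = 1"
    proof (rule ccontr)
      assume "nim_value star \<noteq> 1"
      then have "1 < nim_value star"
        using shrub_game_nim_value_pos[OF star] by linarith
      then obtain X where "X |\<in>| options star" "nim_value X = 1"
        by (rule nim_value_less_option)
      then show False
        by (simp add: star_eq)
    qed
    \<comment> \<open>Commuting \<open>star\<close> to the front makes \<open>S_star\<close> a list
      sum with one more component of value 1, so both parity criteria are reversed. The empty sum is
      included.\<close>
    have "S_star = game_sum (star # ?Hs)"
      using True by (simp add: S_star S game_plus_commute)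
    then have "outcome_normal S_star = Previous_Wins \<longleftrightarrow> odd (ones ?Hs)"
      "outcome_misere S_star = Previous_Wins \<longleftrightarrow> even (ones ?Hs)"
      using outcomes_shrub_game_sum[of "star # ?Hs"] Hs star bigs nim by auto
    with S_out[OF bigs] show ?thesis
      by (metis outcome.exhaust)
  next
    case False
    then obtain G where G: "G \<in> set Gs" "nim_value (hackenbush_game G) \<noteq> 1"
      by blast
    then have "nim_value (hackenbush_game G) > 0"
      using shrubs by (intro shrub_game_nim_value_pos shrub_game_hackenbush_game) blast
    \<comment> \<open>A Shrub has positive value, so a value other than 1 makes it big, and then the
      two conventions give the same outcome.\<close>
    with G(2) have "nim_value (hackenbush_game G) > 1"
      by linarith
    with G(1) have "hackenbush_game G \<in> set (filter (\<lambda>H. nim_value H > 1) ?Hs)"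
      by simp
    then have "bigs ?Hs \<ge> 1"
      unfolding bigs_def by (metis One_nat_def Suc_leI length_pos_if_in_set)
    with outcomes_shrub_game_sum[of ?Hs] Hs have "outcome_normal S = outcome_misere S"
      unfolding S by blast
    moreover have "S_star = S"
      unfolding S_star using False by (rule if_not_P)
    ultimately show ?thesis
      by simp
  qed
qed

end
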